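(* Let $m \geq 3$ be an odd integer and let $G$ and $G'$ be $m$-edge-coloured graphs. Then $G$ and $G'$ are $D_m$-switch equivalent if and only if $\mathit{underlying}(G) \cong \mathit{underlying}(G')$.
   Context: Graphs are finite, undirected and simple (no loops, no multiple edges). An $m$-edge-coloured graph is a pair $G=(H,\Sigma)$ where $H$ is a graph and $\Sigma: E(H)\to\{1,\dots,m\}$ is any function; $\Sigma(e)$ is the colour of $e$. We write $\mathit{underlying}(G)=H$ and $\Sigma(G)=\Sigma$. An isomorphism of $m$-edge-coloured graphs is an isomorphism of the underlying graphs that preserves edge colours. $S_m$ is the symmetric group on $\{1,\dots,m\}$. For $m\ge 3$, $D_m\le S_m$ is the group of permutations of $\{1,\dots,m\}$ corresponding to symmetries of the regular $m$-gon with vertices $1,2,\dots,m$ in cyclic order. Let $\Gamma$ be a subgroup of $S_m$. For a vertex $x$ of $G$ and $\pi\in\Gamma$, switching at $x$ with respect to $\pi$ transforms $G$ into the $m$-edge-coloured graph $G^{(x,\pi)}$ with the same underlying graph, in which each edge $xy$ incident with $x$ has colour $\pi(\Sigma(G)(xy))$ and all other edges keep their colours. A $\Gamma$-switching sequence is a finite sequence $\mathcal{S}=(x_1,\pi_1),\dots,(x_t,\pi_t)$ of elements of $V(G)\times\Gamma$, and $G^{\mathcal{S}}$ is the result of performing these switches successively in order. $G$ and $G'$ are $\Gamma$-switch equivalent if there is a $\Gamma$-switching sequence $\mathcal{S}$ with $G^{\mathcal{S}}\cong G'$ (isomorphism of $m$-edge-coloured graphs). *)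

theory Defs
  imports "HOL-Analysis.Analysis" "HOL-Algebra.Sym_Groups"
begin

record 'a sgraph =
  verts :: "'a set"
  edges :: "'a set set"

definition simple_graph :: "'a sgraph \<Rightarrow> bool" where
  "simple_graph H \<longleftrightarrow> finite (verts H) \<and> (\<forall>e\<in>edges H. e \<subseteq> verts H \<and> card e = 2)"

definition graph_isomorphism :: "('a \<Rightarrow> 'b) \<Rightarrow> 'a sgraph \<Rightarrow> 'b sgraph \<Rightarrow> bool" where
  "graph_isomorphism f H H' \<longleftrightarrow>
     bij_betw f (verts H) (verts H') \<and>
     (\<forall>x\<in>verts H. \<forall>y\<in>verts H. {x, y} \<in> edges H \<longleftrightarrow> {f x, f y} \<in> edges H')"

definition graph_isomorphic :: "'a sgraph \<Rightarrow> 'b sgraph \<Rightarrow> bool" where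
  "graph_isomorphic H H' \<longleftrightarrow> (\<exists>f. graph_isomorphism f H H')"

text \<open>
  The colouring is a total function on vertex sets, but only its values on the edges matter:
  isomorphism of coloured graphs ignores its values elsewhere.
\<close>

type_synonym 'a ecgraph = "'a sgraph \<times> ('a set \<Rightarrow> nat)"

abbreviation underlying :: "'a ecgraph \<Rightarrow> 'a sgraph" where
  "underlying \<equiv> fst"

abbreviation colour :: "'a ecgraph \<Rightarrow> 'a set \<Rightarrow> nat" where
  "colour \<equiv> snd"

definition edge_coloured_graph :: "nat \<Rightarrow> 'a ecgraph \<Rightarrow> bool" where
  "edge_coloured_graph m G \<longleftrightarrow>
     simple_graph (underlying G) \<and> colour G \<in> edges (underlying G) \<rightarrow> {1..m}"

definition ec_isomorphic :: "'a ecgraph \<Rightarrow> 'b ecgraph \<Rightarrow> bool" where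
  "ec_isomorphic G G' \<longleftrightarrow>
     (\<exists>f. graph_isomorphism f (underlying G) (underlying G') \<and>
          (\<forall>e\<in>edges (underlying G). colour G' (f ` e) = colour G e))"

definition switch :: "'a \<times> (nat \<Rightarrow> nat) \<Rightarrow> 'a ecgraph \<Rightarrow> 'a ecgraph" where
  "switch = (\<lambda>(x, \<pi>) G.
     (underlying G,
      \<lambda>e. if e \<in> edges (underlying G) \<and> x \<in> e then \<pi> (colour G e) else colour G e))"

definition switch_sequence ::
  "('a \<times> (nat \<Rightarrow> nat)) list \<Rightarrow> 'a ecgraph \<Rightarrow> 'a ecgraph" where
  "switch_sequence S G = fold switch S G"

definition switch_equivalent ::
  "(nat \<Rightarrow> nat) set \<Rightarrow> 'a ecgraph \<Rightarrow> 'b ecgraph \<Rightarrow> bool" where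
  "switch_equivalent \<Gamma> G G' \<longleftrightarrow>
     (\<exists>S \<in> lists (verts (underlying G) \<times> \<Gamma>). ec_isomorphic (switch_sequence S G) G')"

definition polygon_vertex :: "nat \<Rightarrow> nat \<Rightarrow> complex" where
  "polygon_vertex m k = cis (2 * pi * real k / real m)"

definition regular_polygon :: "nat \<Rightarrow> complex set" where
  "regular_polygon m = convex hull (polygon_vertex m ` {1..m})"

definition polygon_symmetry :: "nat \<Rightarrow> (complex \<Rightarrow> complex) \<Rightarrow> bool" where
  "polygon_symmetry m f \<longleftrightarrow>
     bij f \<and> (\<forall>z w. dist (f z) (f w) = dist z w) \<and> f ` regular_polygon m = regular_polygon m"

definition dihedral :: "nat \<Rightarrow> (nat \<Rightarrow> nat) set" where
  "dihedral m =
     {p \<in> carrier (sym_group m).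
        \<exists>f. polygon_symmetry m f \<and>
            (\<forall>k\<in>{1..m}. f (polygon_vertex m k) = polygon_vertex m (p k))}"

lemma dihedral_subgroup: "subgroup (dihedral m) (sym_group m)"
proof (rule group.subgroupI[OF sym_group_is_group])
  show "dihedral m \<subseteq> carrier (sym_group m)"
    by (auto simp: dihedral_def)
  have "id \<in> dihedral m"
    unfolding dihedral_def polygon_symmetry_def
    by (auto simp: sym_group_carrier permutes_id intro!: exI[of _ id])
  then show "dihedral m \<noteq> {}" by blast
next
  fix p assume "p \<in> dihedral m"
  then obtain f where p: "p permutes {1..m}" and f: "bij f" "\<And>z w. dist (f z) (f w) = dist z w"
      "f ` regular_polygon m = regular_polygon m"
      "\<And>k. k \<in> {1..m} \<Longrightarrow> f (polygon_vertex m k) = polygon_vertex m (p k)"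
    unfolding dihedral_def polygon_symmetry_def by (auto simp: sym_group_carrier)
  let ?g = "Hilbert_Choice.inv f" and ?q = "Hilbert_Choice.inv p"
  have q: "?q permutes {1..m}" using p by (rule permutes_inv)
  have "polygon_symmetry m ?g"
    unfolding polygon_symmetry_def
  proof (intro conjI allI)
    show "bij ?g" using f(1) by (rule bij_imp_bij_inv)
    show "dist (?g z) (?g w) = dist z w" for z w
      using f(2)[of "?g z" "?g w"] f(1) by (simp add: bij_is_surj surj_f_inv_f)
    show "?g ` regular_polygon m = regular_polygon m"
      using f(1,3) by (metis bij_is_inj image_inv_f_f)
  qed
  moreover have "?g (polygon_vertex m k) = polygon_vertex m (?q k)" if "k \<in> {1..m}" for k
  proof -
    have "?q k \<in> {1..m}" using q that by (simp only: permutes_in_image)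
    then have "f (polygon_vertex m (?q k)) = polygon_vertex m k"
      using f(4) p by (simp add: permutes_inverses)
    then show ?thesis using f(1) by (metis bij_is_inj inv_f_f)
  qed
  ultimately have "?q \<in> dihedral m"
    using q unfolding dihedral_def by (auto simp: sym_group_carrier)
  moreover have "inv\<^bsub>sym_group m\<^esub> p = ?q"
    using p by (simp add: sym_group_inv_equality sym_group_carrier)
  ultimately show "inv\<^bsub>sym_group m\<^esub> p \<in> dihedral m" by simp
next
  fix p q assume "p \<in> dihedral m" "q \<in> dihedral m"
  then obtain f g where p: "p permutes {1..m}" and q: "q permutes {1..m}"
    and f: "polygon_symmetry m f"
      "\<And>k. k \<in> {1..m} \<Longrightarrow> f (polygon_vertex m k) = polygon_vertex m (p k)"
    and g: "polygon_symmetry m g"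
      "\<And>k. k \<in> {1..m} \<Longrightarrow> g (polygon_vertex m k) = polygon_vertex m (q k)"
    unfolding dihedral_def by (auto simp: sym_group_carrier)
  have "polygon_symmetry m (f \<circ> g)"
    using f(1) g(1) unfolding polygon_symmetry_def
    by (metis bij_comp comp_apply image_comp)
  moreover have "(f \<circ> g) (polygon_vertex m k) = polygon_vertex m ((p \<circ> q) k)"
    if "k \<in> {1..m}" for k
  proof -
    have "q k \<in> {1..m}" using q that by (simp only: permutes_in_image)
    then show ?thesis using f(2) g(2) that by simp
  qed
  moreover have "p \<circ> q permutes {1..m}" using q p by (rule permutes_compose)
  ultimately have "p \<circ> q \<in> dihedral m"
    unfolding dihedral_def by (auto simp: sym_group_carrier)
  then show "p \<otimes>\<^bsub>sym_group m\<^esub> q \<in> dihedral m"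
    by (simp add: sym_group_mult)
qed

end

theory Submission
  imports Defs "HOL-Number_Theory.Cong"
begin

text \<open>
  Switching never touches the underlying graph, so only one direction has content, and for it
  it suffices to change the colour of a single edge \<open>xy\<close> at will without disturbing any other
  edge. Switch at \<open>x\<close> and \<open>y\<close> alternately, by \<open>p\<close>, \<open>q\<close>, \<open>p\<inverse>\<close>, \<open>q\<inverse>\<close>. An edge meeting
  only one of the two vertices sees a permutation followed by its inverse, whereas the edge \<open>xy\<close>
  sees the commutator of \<open>p\<close> and \<open>q\<close>; this is \<open>switch_commutator\<close>.

  In the dihedral group, take for \<open>p\<close> and \<open>q\<close> the reflections \<open>k \<mapsto> -k\<close> and \<open>k \<mapsto> b - k\<close>
  modulo \<open>m\<close>. Their commutator is the rotation by \<open>2b\<close>, and since \<open>m\<close> is odd, \<open>2b\<close> runs over all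
  residues modulo \<open>m\<close>. Hence every colour can be moved to every other one
  (\<open>reflection_commutator_transitive\<close>). Doing this edge by edge transports the colouring of
  the second graph along an isomorphism of the underlying graphs.
\<close>

section \<open>Switching and commutators\<close>

lemma underlying_switch_sequence [simp]:
  "underlying (switch_sequence S G) = underlying G"
proof -
  have "underlying (fold switch S G) = underlying G" for G :: "'a ecgraph"
    by (induction S arbitrary: G) (auto simp: switch_def)
  then show ?thesis by (simp add: switch_sequence_def)
qed

lemma switch_sequence_append:
  "switch_sequence (S @ T) G = switch_sequence T (switch_sequence S G)"
  by (simp add: switch_sequence_def)

text \<open>
  The switches cancel on every other edge because, in a simple graph, no second edge contains
  both \<open>x\<close> and \<open>y\<close>.
\<close>

lemma switch_commutator:
  assumes H: "simple_graph (underlying G)" and e: "{x, y} \<in> edges (underlying G)"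
    and p: "\<And>k. p' (p k) = k" and q: "\<And>k. q' (q k) = k"
  shows "switch_sequence [(x, p), (y, q), (x, p'), (y, q')] G =
           (underlying G, (colour G)({x, y} := q' (p' (q (p (colour G {x, y}))))))"
proof -
  let ?S = "[(x, p), (y, q), (x, p'), (y, q')]"
  have only: "e' = {x, y}" if "e' \<in> edges (underlying G)" "x \<in> e'" "y \<in> e'" for e'
  proof -
    have "card e' = 2" "card {x, y} = 2" using H e that by (auto simp: simple_graph_def)
    moreover from this have "finite e'" using card.infinite by fastforce
    ultimately show ?thesis using that by (metis bot.extremum card_subset_eq insert_subset)
  qed
  have "colour (switch_sequence ?S G) e' =
          ((colour G)({x, y} := q' (p' (q (p (colour G {x, y})))))) e'" for e'
  proof (cases "e' = {x, y}")
    case True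
    then show ?thesis using e by (simp add: switch_sequence_def switch_def)
  next
    case False
    then have "\<not> (e' \<in> edges (underlying G) \<and> x \<in> e' \<and> y \<in> e')" using only by blast
    then show ?thesis using False by (auto simp: switch_sequence_def switch_def p q)
  qed
  then show ?thesis by (intro prod_eqI) (simp_all add: fun_eq_iff)
qed

section \<open>Reflections of the polygon\<close>

text \<open>
  The reflection \<open>k \<mapsto> a - k\<close> modulo \<open>m\<close>, with residues represented in \<open>{1..m}\<close> (hence the
  shift by one).
\<close>

definition reflection :: "nat \<Rightarrow> int \<Rightarrow> nat \<Rightarrow> nat" where
  "reflection m a k = (if k \<in> {1..m} then nat ((a - int k - 1) mod int m) + 1 else k)"

lemma reflection_in_range: "k \<in> {1..m} \<Longrightarrow> reflection m a k \<in> {1..m}"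
  by (auto simp: reflection_def Suc_le_eq nat_less_iff)

lemma reflection_cong:
  assumes "k \<in> {1..m}"
  shows "[int (reflection m a k) = a - int k] (mod int m)"
proof -
  have "int (reflection m a k) = (a - int k - 1) mod int m + 1"
    using assms by (auto simp: reflection_def)
  moreover have "[(a - int k - 1) mod int m + 1 = a - int k - 1 + 1] (mod int m)"
    by (intro cong_add cong_refl) (simp add: cong_def)
  ultimately show ?thesis by simp
qed

lemma cong_range_imp_eq:
  assumes "i \<in> {1..m}" "j \<in> {1..m}" "[int i = int j] (mod int m)"
  shows "i = j"
proof -
  have "int m dvd int i - int j" using assms(3) by (simp add: cong_iff_dvd_diff)
  moreover have "\<bar>int i - int j\<bar> < int m" using assms(1,2) by auto
  ultimately show ?thesis using zdvd_imp_le[of "int m" "\<bar>int i - int j\<bar>"] by fastforce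
qed

lemma reflection_involution [simp]: "reflection m a (reflection m a k) = k"
proof (cases "k \<in> {1..m}")
  case True
  have "[int (reflection m a (reflection m a k)) = a - int (reflection m a k)] (mod int m)"
    by (intro reflection_cong reflection_in_range True)
  also have "[a - int (reflection m a k) = a - (a - int k)] (mod int m)"
    by (intro cong_diff cong_refl reflection_cong True)
  finally have "[int (reflection m a (reflection m a k)) = int k] (mod int m)" by simp
  then show ?thesis
    using cong_range_imp_eq[OF reflection_in_range[OF reflection_in_range[OF True]] True]
    by blast
next
  case False
  then have "reflection m a k = k" by (auto simp: reflection_def)
  then show ?thesis by simp
qed

lemma reflection_permutes: "reflection m a permutes {1..m}"
proof -
  have "reflection m a k = k" if "k \<notin> {1..m}" for k
    using that by (auto simp: reflection_def)
  then show ?thesis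
    unfolding permutes_def by (metis reflection_involution)
qed

lemma cis_cong:
  assumes "[i = j] (mod int m)" "m > 0"
  shows "cis (2 * pi * of_int i / real m) = cis (2 * pi * of_int j / real m)"
proof -
  obtain t where "i = j + int m * t" using assms(1) by (metis cong_iff_lin cong_sym)
  then have "2 * pi * of_int i / real m = 2 * pi * of_int j / real m + 2 * pi * of_int t"
    using assms(2) by (simp add: field_simps)
  then show ?thesis by (simp flip: cis_mult)
qed

text \<open>
  The map \<open>z \<mapsto> \<omega>\<^sup>a * cnj z\<close>, with \<open>\<omega>\<close> the primitive \<open>m\<close>-th root of unity at angle \<open>2\<pi>/m\<close>,
  is the symmetry of the plane that realises the permutation; being linear, it maps the
  polygon to itself as soon as it permutes the vertices.
\<close>

lemma reflection_in_dihedral: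
  assumes "m > 0"
  shows "reflection m a \<in> dihedral m"
proof -
  define w where "w = cis (2 * pi * of_int a / real m)"
  define f where "f z = w * cnj z" for z
  have ww: "w * cnj w = 1" by (simp add: w_def cis_cnj cis_mult)
  have vertex: "f (polygon_vertex m k) = polygon_vertex m (reflection m a k)"
    if "k \<in> {1..m}" for k
  proof -
    have "f (polygon_vertex m k) = cis (2 * pi * of_int (a - int k) / real m)"
      by (simp add: f_def w_def polygon_vertex_def cis_cnj cis_mult
          right_diff_distrib diff_divide_distrib)
    also have "\<dots> = cis (2 * pi * of_int (int (reflection m a k)) / real m)"
      by (rule cis_cong[OF cong_sym[OF reflection_cong[OF that]] assms])
    finally show ?thesis by (simp add: polygon_vertex_def)
  qed
  have "f (f z) = z" for z
    using ww by (simp add: f_def flip: mult.assoc)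
  then have "bij f" by (rule involuntory_imp_bij)
  moreover have "dist (f z) (f z') = dist z z'" for z z'
  proof -
    have "f z - f z' = w * cnj (z - z')" by (simp add: f_def right_diff_distrib)
    then show ?thesis by (simp add: dist_norm norm_mult w_def del: complex_cnj_diff)
  qed
  moreover have "f ` regular_polygon m = regular_polygon m"
  proof -
    have "linear f" by (rule linearI) (simp_all add: f_def algebra_simps)
    then have "f ` regular_polygon m = convex hull (f ` polygon_vertex m ` {1..m})"
      by (simp add: regular_polygon_def convex_hull_linear_image)
    also have "f ` polygon_vertex m ` {1..m} = polygon_vertex m ` reflection m a ` {1..m}"
      using vertex by (auto simp: image_image)
    finally show ?thesis
      by (simp only: regular_polygon_def permutes_image[OF reflection_permutes])
  qed
  ultimately have "polygon_symmetry m f" by (simp add: polygon_symmetry_def)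
  then show ?thesis
    using vertex reflection_permutes by (auto simp: dihedral_def sym_group_carrier)
qed

lemma reflection_commutator_transitive:
  assumes "odd m" "c \<in> {1..m}" "d \<in> {1..m}"
  obtains a b where
    "reflection m b (reflection m a (reflection m b (reflection m a c))) = d"
proof -
  \<comment> \<open>The commutator adds \<open>2 * b\<close>, and \<open>(m + 1) div 2\<close> is the inverse of 2 modulo \<open>m\<close>.\<close>
  define b where "b = (int d - int c) * ((int m + 1) div 2)"
  let ?p = "reflection m 0" and ?q = "reflection m b"
  have range: "?p c \<in> {1..m}" "?q (?p c) \<in> {1..m}" "?p (?q (?p c)) \<in> {1..m}"
    "?q (?p (?q (?p c))) \<in> {1..m}"
    using assms(2) by (simp_all only: reflection_in_range)
  have "2 * b = (int d - int c) * (2 * ((int m + 1) div 2))"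
    by (simp add: b_def)
  also have "2 * ((int m + 1) div 2) = int m + 1"
    using assms(1) by (intro dvd_mult_div_cancel) simp
  finally have twice: "2 * b = (int d - int c) * (int m + 1)" .
  have "[int (?q (?p (?q (?p c)))) = b - int (?p (?q (?p c)))] (mod int m)"
    by (rule reflection_cong[OF range(3)])
  also have "[b - int (?p (?q (?p c))) = b - (0 - int (?q (?p c)))] (mod int m)"
    by (intro cong_diff cong_refl reflection_cong range)
  also have "[b - (0 - int (?q (?p c))) = b - (0 - (b - int (?p c)))] (mod int m)"
    by (intro cong_diff cong_refl reflection_cong range)
  also have "[b - (0 - (b - int (?p c))) = b - (0 - (b - (0 - int c)))] (mod int m)"
    by (intro cong_diff cong_refl reflection_cong assms)
  also have "b - (0 - (b - (0 - int c))) = int d + int m * (int d - int c)"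
    using twice by (simp add: algebra_simps)
  also have "[int d + int m * (int d - int c) = int d] (mod int m)"
    by (simp add: cong_def)
  finally show thesis
    using that cong_range_imp_eq[OF range(4) assms(3)] by blast
qed

section \<open>Recolouring edge by edge\<close>

lemma recolour_edge:
  fixes G :: "'a ecgraph"
  assumes "odd m" and H: "simple_graph (underlying G)" and e: "e \<in> edges (underlying G)"
    and "colour G e \<in> {1..m}" and "d \<in> {1..m}"
  obtains S where "S \<in> lists (verts (underlying G) \<times> dihedral m)"
    and "switch_sequence S G = (underlying G, (colour G)(e := d))"
proof -
  have "card e = 2" "e \<subseteq> verts (underlying G)" using H e by (auto simp: simple_graph_def)
  then obtain x y where xy: "e = {x, y}" "x \<in> verts (underlying G)" "y \<in> verts (underlying G)"
    by (auto simp: card_2_iff)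
  obtain a b where
    ab: "reflection m b (reflection m a (reflection m b (reflection m a (colour G e)))) = d"
    using reflection_commutator_transitive assms(1,4,5) by blast
  let ?S = "[(x, reflection m a), (y, reflection m b), (x, reflection m a), (y, reflection m b)]"
  have "m > 0" using assms(1) by (auto intro: odd_pos)
  show thesis
  proof (rule that)
    show "?S \<in> lists (verts (underlying G) \<times> dihedral m)"
      using xy reflection_in_dihedral[OF \<open>m > 0\<close>] by simp
    show "switch_sequence ?S G = (underlying G, (colour G)(e := d))"
      using ab e H by (simp add: xy switch_commutator)
  qed
qed

text \<open>
  The sequence is required to keep the colours outside \<open>F\<close>, so that edges recoloured
  earlier stay as they are when the next one is treated.
\<close>

lemma recolour_edges:
  fixes G :: "'a ecgraph"
  assumes "odd m" and G: "edge_coloured_graph m G"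
    and "finite F" and "F \<subseteq> edges (underlying G)" and "c \<in> F \<rightarrow> {1..m}"
  shows "\<exists>S \<in> lists (verts (underlying G) \<times> dihedral m).
           switch_sequence S G = (underlying G, override_on (colour G) c F)"
  using assms(3-5)
proof (induction F rule: finite_induct)
  case empty
  show ?case by (rule bexI[of _ "[]"]) (simp_all add: switch_sequence_def)
next
  case (insert e F)
  then obtain S where S: "S \<in> lists (verts (underlying G) \<times> dihedral m)"
    and SG: "switch_sequence S G = (underlying G, override_on (colour G) c F)"
    by auto
  let ?G = "switch_sequence S G"
  obtain T where T: "T \<in> lists (verts (underlying ?G) \<times> dihedral m)"
    and TG: "switch_sequence T ?G = (underlying ?G, (colour ?G)(e := c e))"
  proof (rule recolour_edge[of m ?G e "c e"])
    show "colour ?G e \<in> {1..m}"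
      using G insert.prems insert.hyps by (auto simp: SG edge_coloured_graph_def)
  qed (use assms(1) G insert.prems in \<open>auto simp: edge_coloured_graph_def\<close>)
  have "switch_sequence (S @ T) G = (underlying G, override_on (colour G) c (insert e F))"
    using TG by (simp add: switch_sequence_append SG override_on_insert)
  moreover have "S @ T \<in> lists (verts (underlying G) \<times> dihedral m)"
    using S T by simp
  ultimately show ?case by blast
qed

lemma finite_edges: "simple_graph H \<Longrightarrow> finite (edges H)"
  by (rule finite_subset[of _ "Pow (verts H)"]) (auto simp: simple_graph_def)

lemma graph_isomorphism_image_edge:
  assumes "graph_isomorphism f H H'" "simple_graph H" "e \<in> edges H"
  shows "f ` e \<in> edges H'"
proof -
  obtain x y where "e = {x, y}" "x \<in> verts H" "y \<in> verts H"
    using assms(2,3) by (auto simp: simple_graph_def card_2_iff)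
  then show ?thesis using assms(1,3) by (auto simp: graph_isomorphism_def)
qed

theorem corollary3p2:
  fixes m :: nat and G :: "'a ecgraph" and G' :: "'b ecgraph"
  assumes "m \<ge> 3" and "odd m"
    and "edge_coloured_graph m G" and "edge_coloured_graph m G'"
  shows "switch_equivalent (dihedral m) G G' \<longleftrightarrow>
         graph_isomorphic (underlying G) (underlying G')"
proof
  assume "switch_equivalent (dihedral m) G G'"
  then show "graph_isomorphic (underlying G) (underlying G')"
    by (auto simp: switch_equivalent_def ec_isomorphic_def graph_isomorphic_def)
next
  assume "graph_isomorphic (underlying G) (underlying G')"
  then obtain f where f: "graph_isomorphism f (underlying G) (underlying G')"
    by (auto simp: graph_isomorphic_def)
  have H: "simple_graph (underlying G)"
    using assms(3) by (simp add: edge_coloured_graph_def)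
  let ?c = "\<lambda>e. colour G' (f ` e)"
  have "?c \<in> edges (underlying G) \<rightarrow> {1..m}"
    using assms(4) graph_isomorphism_image_edge[OF f H]
    by (auto simp: edge_coloured_graph_def Pi_iff)
  then obtain S where S: "S \<in> lists (verts (underlying G) \<times> dihedral m)"
    and SG: "switch_sequence S G =
               (underlying G, override_on (colour G) ?c (edges (underlying G)))"
    using recolour_edges[OF assms(2,3) finite_edges[OF H] subset_refl] by blast
  have "ec_isomorphic (switch_sequence S G) G'"
    unfolding ec_isomorphic_def using f by (auto simp: SG)
  with S show "switch_equivalent (dihedral m) G G'"
    by (auto simp: switch_equivalent_def)
qed

end
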